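(* Let $p$ be an odd prime and $x\in\mathbb Q_p\setminus\mathbb Z_p$. (1) For every $m\in\mathbb Z\setminus\{0\}$, $$\zeta_{p,E}(1+m,x)=\omega_v(x)^m\int_{\mathbb Z_p}\frac{1}{(x+a)^m}\,d\mu_{-1}(a).$$ (2) For every integer $m>0$, $$\zeta_{p,E}(1-m,x)=\frac{1}{\omega_v(x)^{m}}E_m(x).$$ (3) For $s\in\mathbb C_p$ with $|s|_p<R_p$, $$\frac{\partial}{\partial x}\zeta_{p,E}(s,x)=\frac{1-s}{\omega_v(x)}\zeta_{p,E}(s+1,x).$$
   Context: $p$ is an odd prime; $\mathbb Z_p\subset\mathbb Q_p\subset\mathbb C_p$, $v_p$ the $p$-adic valuation. For $f:\mathbb Z_p\to\mathbb C_p$ uniformly differentiable, $\int_{\mathbb Z_p}f(a)\,d\mu_{-1}(a)=\lim_{N\to\infty}\sum_{a=0}^{p^N-1}(-1)^af(a)$. For $y\in\mathbb Z_p^\times$, $\omega(y)$ is the $(p-1)$-th root of unity with $\omega(y)\equiv y\pmod p$ and $\langle y\rangle=y/\omega(y)$; for $y\in\mathbb Q_p^\times$, $\langle y\rangle=\langle y/p^{v_p(y)}\rangle$ and $\omega_v(y)=y/\langle y\rangle=p^{v_p(y)}\omega(y/p^{v_p(y)})$. For $|t|_p<R_p=p^{(p-2)/(p-1)}$, $\langle y\rangle^{t}=\sum_{k\ge0}\binom tk(\langle y\rangle-1)^k$. Euler polynomials: $\frac{2e^{xt}}{e^t+1}=\sum_{m\ge0}E_m(x)\frac{t^m}{m!}$.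 For $x\in\mathbb Q_p\setminus\mathbb Z_p$ and $|s|_p<R_p$, $\zeta_{p,E}(s,x)=\int_{\mathbb Z_p}\langle x+a\rangle^{1-s}\,d\mu_{-1}(a)$; the derivative in (3) is with respect to the variable $x\in\mathbb Q_p\setminus\mathbb Z_p$. *)

theory Defs
  imports
    "HOL-Analysis.Analysis"
    "HOL-Computational_Algebra.Computational_Algebra"
begin

section \<open>The field of complex $p$-adic numbers\<close>

text \<open>
  A field of characteristic 0 with a multiplicative ultrametric absolute value \<open>vabs\<close>.
  Nonnegativity and definiteness of \<open>vabs\<close> follow from the metric axioms. The constant
  \<open>norm\<close> of the library cannot be used here, as it is reserved for real normed vector spaces.
\<close>

class ultrametric_field = field_char_0 + metric_space +
  fixes vabs :: "'a \<Rightarrow> real"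
  assumes dist_vabs: "dist x y = vabs (x - y)"
    and vabs_mult: "vabs (x * y) = vabs x * vabs y"
    and vabs_add_le_max: "vabs (x + y) \<le> max (vabs x) (vabs y)"

definition Qp :: "'a::ultrametric_field set" where
  "Qp = closure (range of_rat)"

definition Zp :: "'a::ultrametric_field set" where
  "Zp = {x \<in> Qp. vabs x \<le> 1}"

definition Qp_alg :: "'a::ultrametric_field set" where
  "Qp_alg = {x. \<exists>f. f \<noteq> 0 \<and> (\<forall>i. coeff f i \<in> Qp) \<and> poly f x = 0}"

text \<open>
  The type \<open>'a\<close> is a copy of \<open>\<complex>\<^sub>p\<close>, i.e. a completion of an algebraic closure of \<open>\<rat>\<^sub>p\<close>:
  \<open>vabs\<close> extends the \<open>p\<close>-adic absolute value of the integers (hence of the rationals), so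
  that in the complete field \<open>'a\<close> the set \<^const>\<open>Qp\<close> is the completion of the rationals; the
  elements algebraic over it form an algebraically closed field, and this field is dense.
  These conditions determine \<open>'a\<close> up to isometric isomorphism.
\<close>

definition is_Cp :: "nat \<Rightarrow> 'a::{ultrametric_field, complete_space} itself \<Rightarrow> bool" where
  "is_Cp p (K :: 'a itself) \<longleftrightarrow>
     prime p \<and>
     (\<forall>n::int. n \<noteq> 0 \<longrightarrow> vabs (of_int n :: 'a) = 1 / real p ^ multiplicity (int p) n) \<and>
     (\<forall>f :: 'a poly. (\<forall>i. coeff f i \<in> Qp_alg) \<and> degree f > 0 \<longrightarrow> (\<exists>z\<in>Qp_alg. poly f z = 0)) \<and>
     closure (Qp_alg :: 'a set) = UNIV"


section \<open>Teichmueller character, projection and powers\<close>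

text \<open>Only meaningful for nonzero elements of \<^const>\<open>Qp\<close>.\<close>

definition padic_val :: "nat \<Rightarrow> 'a::ultrametric_field \<Rightarrow> int" where
  "padic_val p y = (THE n. vabs y = real p powi (- n))"

text \<open>
  Only meaningful for units of \<^const>\<open>Zp\<close>; this is \<open>\<omega>\<close>, and the last conjunct is the congruence
  \<open>\<omega>(y) \<equiv> y\<close> modulo \<open>p\<close> in \<^const>\<open>Zp\<close>.
\<close>

definition teichmueller :: "nat \<Rightarrow> 'a::ultrametric_field \<Rightarrow> 'a" where
  "teichmueller p y =
     (THE w. w \<in> Zp \<and> w ^ (p - 1) = 1 \<and> (\<exists>z\<in>Zp. w - y = of_nat p * z))"

text \<open>
  The projection \<open>\<langle>y\<rangle>\<close> for nonzero \<open>y\<close> in \<^const>\<open>Qp\<close>; on units of \<^const>\<open>Zp\<close>, where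
  the valuation is 0, it is \<open>y / \<omega>(y)\<close>.
\<close>

definition angle_proj :: "nat \<Rightarrow> 'a::ultrametric_field \<Rightarrow> 'a" where
  "angle_proj p y =
     (let u = y / of_nat p powi padic_val p y in u / teichmueller p u)"

definition omega_v :: "nat \<Rightarrow> 'a::ultrametric_field \<Rightarrow> 'a" where
  "omega_v p y = y / angle_proj p y"

text \<open>The power \<open>\<langle>y\<rangle>\<^sup>t\<close>, used for exponents with \<open>vabs t < R_p p\<close>, where the series converges.\<close>

definition angle_pow :: "nat \<Rightarrow> 'a::ultrametric_field \<Rightarrow> 'a \<Rightarrow> 'a" where
  "angle_pow p y t = (\<Sum>k. (t gchoose k) * (angle_proj p y - 1) ^ k)"

definition R_p :: "nat \<Rightarrow> real" where
  "R_p p = real p powr ((real p - 2) / (real p - 1))"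


section \<open>Fermionic integral, Euler polynomials and the zeta function\<close>

text \<open>The limit exists whenever \<open>f\<close> is uniformly differentiable on \<^const>\<open>Zp\<close>.\<close>

definition fermionic_integral :: "nat \<Rightarrow> ('a::ultrametric_field \<Rightarrow> 'a) \<Rightarrow> 'a" where
  "fermionic_integral p f = lim (\<lambda>N. \<Sum>a<p ^ N. (- 1) ^ a * f (of_nat a))"

definition euler_poly :: "nat \<Rightarrow> 'a::field_char_0 \<Rightarrow> 'a" where
  "euler_poly m x = fact m * fps_nth (2 * fps_exp x / (fps_exp 1 + 1)) m"

definition zeta_pE :: "nat \<Rightarrow> 'a::ultrametric_field \<Rightarrow> 'a \<Rightarrow> 'a" where
  "zeta_pE p s x = fermionic_integral p (\<lambda>a. angle_pow p (x + a) (1 - s))"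

text \<open>
  The library's \<open>has_field_derivative\<close> requires a real normed field, which \<open>\<complex>\<^sub>p\<close> is not.
\<close>

definition has_padic_derivative ::
    "('a::ultrametric_field \<Rightarrow> 'a) \<Rightarrow> 'a \<Rightarrow> 'a \<Rightarrow> 'a set \<Rightarrow> bool" where
  "has_padic_derivative f D x S \<longleftrightarrow>
     ((\<lambda>y. (f y - f x) / (y - x)) \<longlongrightarrow> D) (at x within S)"

end

theory Submission
  imports Defs "HOL-Number_Theory.Residues"
begin

text \<open>
  For \<open>x\<close> outside \<^const>\<open>Zp\<close> the character \<^const>\<open>omega_v\<close> is constant on the unit ball around \<open>x\<close>
  in \<^const>\<open>Qp\<close>, so there the projection \<^const>\<open>angle_proj\<close> is division by \<open>w = omega_v p x\<close>,
  and \<open>\<langle>y + a\<rangle>\<^sup>t\<close> is the binomial series in \<open>(y + a) / w - 1\<close>, whose absolute value is at most \<open>1 / p\<close>.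
  Legendre's bound for \<open>k!\<close> gives \<open>\<bar>t gchoose k\<bar> \<le> p ^ k\<close> for \<open>\<bar>t\<bar> < R_p p\<close>, hence a
  Lipschitz estimate and a second order Taylor estimate for this series, uniformly in \<open>a\<close>.
  Since fermionic integrals of Lipschitz functions converge and are bounded by the supremum of
  the integrand, differentiation passes under the integral, which is (3). For integer \<open>t\<close> the
  series is an ordinary power, which is (1), and (2) then follows by telescoping with
  \<open>E\<^sub>m(x + 1) + E\<^sub>m(x) = 2 x\<^sup>m\<close>.
\<close>

section \<open>Ultrametric fields\<close>

lemma vabs_eq_dist: "vabs x = dist x (0::'a::ultrametric_field)"
  by (simp add: dist_vabs)

lemma vabs_nonneg [simp]: "0 \<le> vabs x"
  by (simp add: vabs_eq_dist)

lemma vabs_eq_0_iff [simp]: "vabs x = 0 \<longleftrightarrow> x = 0"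
  by (simp add: vabs_eq_dist)

lemma vabs_0 [simp]: "vabs 0 = 0"
  by simp

lemma vabs_pos_iff [simp]: "0 < vabs x \<longleftrightarrow> x \<noteq> 0"
  by (simp add: vabs_eq_dist)

lemma vabs_1 [simp]: "vabs 1 = 1"
  using vabs_mult[of 1 1] by simp

lemma vabs_minus [simp]: "vabs (- x) = vabs x"
  using dist_commute[of 0 x] by (simp add: dist_vabs)

lemma vabs_minus_commute: "vabs (x - y) = vabs (y - x)"
  using vabs_minus[of "x - y"] by simp

lemma vabs_power: "vabs (x ^ n) = vabs x ^ n"
  by (induction n) (simp_all add: vabs_mult)

lemma vabs_inverse: "vabs (inverse x) = inverse (vabs x)"
proof (cases "x = 0")
  case False
  then have "vabs x * vabs (inverse x) = 1"
    by (simp flip: vabs_mult)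
  then show ?thesis
    by (simp add: inverse_unique)
qed auto

lemma vabs_divide: "vabs (x / y) = vabs x / vabs y"
  by (simp add: divide_inverse vabs_mult vabs_inverse)

lemma vabs_power_int: "vabs (x powi n) = vabs x powi n"
  by (simp add: power_int_def vabs_power vabs_inverse)

lemma vabs_prod: "vabs (prod f A) = (\<Prod>i\<in>A. vabs (f i))"
  by (induction A rule: infinite_finite_induct) (simp_all add: vabs_mult)

lemma vabs_add_le: "vabs x \<le> B \<Longrightarrow> vabs y \<le> B \<Longrightarrow> vabs (x + y) \<le> B"
  using vabs_add_le_max[of x y] by linarith

lemma vabs_diff_le: "vabs x \<le> B \<Longrightarrow> vabs y \<le> B \<Longrightarrow> vabs (x - y) \<le> B"
  using vabs_add_le[of x B "- y"] by simp

lemma vabs_diff_trans: "vabs (x - y) \<le> B \<Longrightarrow> vabs (y - z) \<le> B \<Longrightarrow> vabs (x - z) \<le> B"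
  using vabs_add_le[of "x - y" B "y - z"] by simp

text \<open>The isosceles triangle principle: if \<open>y\<close> were smaller than
  \<open>x\<close>, then \<open>x = (x - y) + y\<close> would be a sum of two elements both smaller
  than \<open>x\<close>.\<close>

lemma vabs_eqI:
  assumes "vabs (x - y) < vabs x"
  shows "vabs y = vabs x"
proof (rule antisym)
  show "vabs y \<le> vabs x"
    using vabs_diff_le[of x "vabs x" "x - y"] assms by simp
  show "vabs x \<le> vabs y"
  proof (rule ccontr)
    assume "\<not> ?thesis"
    then show False
      using vabs_add_le_max[of "x - y" y] assms by simp
  qed
qed

lemma vabs_sum_le:
  assumes "\<And>i. i \<in> A \<Longrightarrow> vabs (f i) \<le> B" "0 \<le> B"
  shows "vabs (sum f A) \<le> B"
  using assms(1)
proof (induction A rule: infinite_finite_induct)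
  case (insert i A)
  then show ?case
    by (simp add: vabs_add_le)
qed (use assms(2) in auto)

lemma vabs_neg_one_power [simp]: "vabs ((- 1) ^ n) = 1"
  by (simp add: vabs_power)

section \<open>Limits, continuity of the field operations, and series\<close>

lemma tendsto_vabs_iff: "(f \<longlongrightarrow> l) F \<longleftrightarrow> ((\<lambda>x. vabs (f x - l)) \<longlongrightarrow> 0) F"
  by (subst tendsto_dist_iff) (simp add: dist_vabs)

lemma tendsto_vabs:
  assumes "(f \<longlongrightarrow> l) F"
  shows "((\<lambda>x. vabs (f x)) \<longlongrightarrow> vabs l) F"
  unfolding vabs_eq_dist by (intro tendsto_intros assms)

text \<open>Registering the class relation makes the library rules for limits of sums, differences
  and negatives available in \<open>'a\<close>.\<close>

instance ultrametric_field \<subseteq> topological_ab_group_add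
proof
  fix a b :: 'a
  have fst: "((\<lambda>z. vabs (fst z - a)) \<longlongrightarrow> 0) (nhds a \<times>\<^sub>F nhds b)"
    by (simp flip: tendsto_vabs_iff add: filterlim_fst)
  have snd: "((\<lambda>z. vabs (snd z - b)) \<longlongrightarrow> 0) (nhds a \<times>\<^sub>F nhds b)"
    by (simp flip: tendsto_vabs_iff add: filterlim_snd)
  have "((\<lambda>z. vabs (fst z + snd z - (a + b))) \<longlongrightarrow> 0) (nhds a \<times>\<^sub>F nhds b)"
  proof (rule tendsto_sandwich[OF _ _ tendsto_const])
    show "((\<lambda>z. max (vabs (fst z - a)) (vabs (snd z - b))) \<longlongrightarrow> 0) (nhds a \<times>\<^sub>F nhds b)"
      using tendsto_max[OF fst snd] by simp
    show "\<forall>\<^sub>F z in nhds a \<times>\<^sub>F nhds b. vabs (fst z + snd z - (a + b)) \<le>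
            max (vabs (fst z - a)) (vabs (snd z - b))"
      using vabs_add_le_max[of "fst z - a" "snd z - b" for z :: "'a \<times> 'a"]
      by (simp add: algebra_simps)
  qed simp
  then show "filterlim (\<lambda>z. fst z + snd z) (nhds (a + b)) (nhds a \<times>\<^sub>F nhds b)"
    using tendsto_vabs_iff by blast
  have "((\<lambda>z. vabs (- z - (- a))) \<longlongrightarrow> 0) (nhds a)"
    using tendsto_vabs_iff[of "\<lambda>z. z" a "nhds a"]
    by (simp add: vabs_minus_commute filterlim_ident)
  then show "(uminus \<longlongrightarrow> - a) (nhds a)"
    using tendsto_vabs_iff[of uminus] by blast
qed

instance ultrametric_field \<subseteq> topological_comm_monoid_mult
proof
  fix a b :: 'a
  let ?F = "nhds a \<times>\<^sub>F nhds b"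
  have fst: "((\<lambda>z. vabs (fst z - a)) \<longlongrightarrow> 0) ?F"
    by (simp flip: tendsto_vabs_iff add: filterlim_fst)
  have snd: "((\<lambda>z. vabs (snd z - b)) \<longlongrightarrow> 0) ?F"
    by (simp flip: tendsto_vabs_iff add: filterlim_snd)
  have *: "((\<lambda>z. (fst z - a) * (snd z - b)) \<longlongrightarrow> 0) ?F"
    using tendsto_mult[OF fst snd] by (simp add: tendsto_vabs_iff vabs_mult)
  have **: "((\<lambda>z. a * (snd z - b)) \<longlongrightarrow> 0) ?F"
    using tendsto_mult[OF tendsto_const snd, of "vabs a"] by (simp add: tendsto_vabs_iff vabs_mult)
  have ***: "((\<lambda>z. (fst z - a) * b) \<longlongrightarrow> 0) ?F"
    using tendsto_mult[OF fst tendsto_const, of "vabs b"] by (simp add: tendsto_vabs_iff vabs_mult)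
  \<comment> \<open>Expand the product around \<open>(a, b)\<close>: every term except
    \<open>a * b\<close> contains a factor that tends to 0.\<close>
  have "((\<lambda>z. (fst z - a) * (snd z - b) + a * (snd z - b) + (fst z - a) * b + a * b)
           \<longlongrightarrow> 0 + 0 + 0 + a * b) ?F"
    by (intro tendsto_add tendsto_const * ** ***)
  then show "filterlim (\<lambda>z. fst z * snd z) (nhds (a * b)) ?F"
    by (simp add: algebra_simps)
qed

lemma tendsto_0_if_vabs_le:
  assumes "\<And>x. vabs (f x) \<le> g x" "(g \<longlongrightarrow> 0) F"
  shows "(f \<longlongrightarrow> 0) F"
proof -
  have "((\<lambda>x. vabs (f x)) \<longlongrightarrow> 0) F"
    by (rule tendsto_sandwich[OF _ _ tendsto_const assms(2)]) (simp_all add: assms(1))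
  then show ?thesis
    by (simp add: tendsto_vabs_iff)
qed

lemma vabs_lim_le:
  assumes "X \<longlonglongrightarrow> l" "\<And>n. vabs (X n) \<le> B"
  shows "vabs l \<le> B"
  by (rule LIMSEQ_le_const2[OF tendsto_vabs[OF assms(1)]]) (use assms(2) in auto)

text \<open>\<open>X m - X n\<close> telescopes into single steps, and the ultrametric inequality
  bounds it by the largest of them, so small steps already make the sequence Cauchy.\<close>

lemma convergent_if_diff_tendsto_0:
  fixes X :: "nat \<Rightarrow> 'a::{ultrametric_field, complete_space}"
  assumes "(\<lambda>n. X (Suc n) - X n) \<longlonglongrightarrow> 0"
  shows "convergent X"
proof -
  have "Cauchy X"
  proof (rule metric_CauchyI)
    fix e :: real
    assume "e > 0"
    then obtain N where N: "\<And>n. n \<ge> N \<Longrightarrow> vabs (X (Suc n) - X n) < e / 2"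
      using metric_LIMSEQ_D[OF assms, of "e / 2"] by (auto simp: dist_vabs)
    have "vabs (X n - X N) \<le> e / 2" if "n \<ge> N" for n
      using that
    proof (induction n rule: dec_induct)
      case (step n)
      show ?case
        by (rule vabs_diff_trans[OF _ step.IH]) (use N step in force)
    qed (use \<open>e > 0\<close> in simp)
    then have "vabs (X m - X n) < e" if "m \<ge> N" "n \<ge> N" for m n
      using that \<open>e > 0\<close> vabs_diff_trans[of "X m" "X N" "e / 2" "X n"]
      by (force simp: vabs_minus_commute)
    then show "\<exists>M. \<forall>m\<ge>M. \<forall>n\<ge>M. dist (X m) (X n) < e"
      by (auto simp: dist_vabs)
  qed
  then show ?thesis
    by (rule Cauchy_convergent)
qed

lemma ultrametric_summable:
  fixes f :: "nat \<Rightarrow> 'a::{ultrametric_field, complete_space}"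
  assumes "f \<longlonglongrightarrow> 0"
  shows "summable f"
  unfolding summable_iff_convergent
  by (rule convergent_if_diff_tendsto_0) (simp add: assms)

lemma vabs_sums_le:
  assumes "f sums s" "\<And>k. vabs (f k) \<le> B"
  shows "vabs s \<le> B"
  by (rule vabs_lim_le[OF assms(1)[unfolded sums_def]], rule vabs_sum_le)
     (use assms(2) order_trans[OF vabs_nonneg] in blast)+

lemma ultrametric_sums_mult:
  fixes f :: "nat \<Rightarrow> 'a::ultrametric_field"
  assumes "f sums s"
  shows "(\<lambda>n. c * f n) sums (c * s)"
  using tendsto_mult_left[OF assms[unfolded sums_def]] by (simp add: sums_def sum_distrib_left)

lemma ultrametric_sums_diff:
  fixes f g :: "nat \<Rightarrow> 'a::ultrametric_field"
  assumes "f sums a" "g sums b"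
  shows "(\<lambda>n. f n - g n) sums (a - b)"
  using tendsto_diff[OF assms[unfolded sums_def]] by (simp add: sums_def sum_subtractf)

lemma sums_tail:
  fixes f :: "nat \<Rightarrow> 'a::ultrametric_field"
  assumes "f sums s"
  shows "(\<lambda>n. f (Suc n)) sums (s - f 0)"
  using tendsto_diff[OF LIMSEQ_Suc[OF assms[unfolded sums_def]] tendsto_const, of "f 0"]
  by (simp add: sums_def sum.lessThan_Suc_shift del: sum.lessThan_Suc)

text \<open>Induction with \<open>z' ^ Suc k - z ^ Suc k = z' * (z' ^ k - z ^ k) + (z' - z) * z ^
  k\<close>. The factor \<open>r\<close> on the left replaces an exponent \<open>k - 1\<close> on
  the right, which keeps \<open>k = 0\<close> and \<open>r = 0\<close> uniform.\<close>

lemma vabs_power_diff_le: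
  assumes "vabs z \<le> r" "vabs z' \<le> r"
  shows "r * vabs (z' ^ k - z ^ k) \<le> vabs (z' - z) * r ^ k"
proof -
  have r: "r \<ge> 0"
    using assms(1) vabs_nonneg[of z] by linarith
  show ?thesis
  proof (induction k)
    case (Suc k)
    have "vabs (z' ^ Suc k - z ^ Suc k) = vabs (z' * (z' ^ k - z ^ k) + (z' - z) * z ^ k)"
      by (simp add: algebra_simps)
    also have "\<dots> \<le> max (r * vabs (z' ^ k - z ^ k)) (vabs (z' - z) * r ^ k)"
      by (rule order_trans[OF vabs_add_le_max])
         (intro max.mono, use assms r in \<open>auto simp: vabs_mult vabs_power intro!: mult_mono power_mono\<close>)
    also have "\<dots> \<le> vabs (z' - z) * r ^ k"
      using Suc by simp
    finally show ?case
      using mult_left_mono[OF _ r] by (fastforce simp: algebra_simps)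
  qed (use r in simp)
qed

text \<open>The Taylor remainder \<open>D\<close> satisfies
  \<open>D (Suc k) = z * D k + (z' - z) * (z' ^ k - z ^ k)\<close>, and the first order estimate
  controls the last term. At \<open>k = 0\<close> the truncated exponent \<open>k - 1\<close> is
  harmless because its coefficient is 0.\<close>

lemma vabs_power_diff_second_order_le:
  assumes "vabs z \<le> r" "vabs z' \<le> r"
  shows "r\<^sup>2 * vabs (z' ^ k - z ^ k - of_nat k * (z' - z) * z ^ (k - 1)) \<le> vabs (z' - z) ^ 2 * r ^ k"
proof -
  have r: "r \<ge> 0"
    using assms(1) vabs_nonneg[of z] by linarith
  define D where "D k = z' ^ k - z ^ k - of_nat k * (z' - z) * z ^ (k - 1)" for k
  have D_Suc: "D (Suc k) = z * D k + (z' - z) * (z' ^ k - z ^ k)" for k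
    by (cases k) (simp_all add: D_def algebra_simps)
  have "r\<^sup>2 * vabs (D k) \<le> vabs (z' - z) ^ 2 * r ^ k"
  proof (induction k)
    case (Suc k)
    have "r\<^sup>2 * vabs (D (Suc k)) \<le> r\<^sup>2 * max (r * vabs (D k)) (vabs (z' - z) * vabs (z' ^ k - z ^ k))"
      unfolding D_Suc
      by (intro mult_left_mono order_trans[OF vabs_add_le_max] max.mono)
         (use assms r in \<open>auto simp: vabs_mult vabs_power intro!: mult_right_mono\<close>)
    also have "\<dots> = max (r * (r\<^sup>2 * vabs (D k))) (r * vabs (z' - z) * (r * vabs (z' ^ k - z ^ k)))"
      using r by (simp add: max_mult_distrib_left power2_eq_square mult_ac)
    also have "\<dots> \<le> vabs (z' - z) ^ 2 * r ^ Suc k"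
    proof (rule max.boundedI)
      show "r * (r\<^sup>2 * vabs (D k)) \<le> vabs (z' - z) ^ 2 * r ^ Suc k"
        using mult_left_mono[OF Suc r] by (simp add: mult_ac)
      show "r * vabs (z' - z) * (r * vabs (z' ^ k - z ^ k)) \<le> vabs (z' - z) ^ 2 * r ^ Suc k"
        using mult_left_mono[OF vabs_power_diff_le[OF assms, of k], of "r * vabs (z' - z)"] r
        by (simp add: power2_eq_square mult_ac)
    qed
    finally show ?case .
  qed (simp add: D_def)
  then show ?thesis
    by (simp add: D_def)
qed


section \<open>The field \<open>\<rat>\<^sub>p\<close> and the Teichmueller character\<close>

locale padic_field =
  fixes p :: nat and K :: "'a::{ultrametric_field, complete_space} itself"
  assumes prime_p: "prime p" and odd_p: "odd p"
    and vabs_of_int: "n \<noteq> 0 \<Longrightarrow> vabs (of_int n :: 'a) = 1 / real p ^ multiplicity (int p) n"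
begin

section \<open>Absolute values of integers and rationals, and Fermat's congruence\<close>

lemma p_gt_2: "p > 2"
  using prime_p odd_p prime_ge_2_nat[of p] by (cases "p = 2") auto

lemma p_pos: "real p > 0"
  using p_gt_2 by simp

lemma vabs_of_int_le_1: "vabs (of_int n :: 'a) \<le> 1"
  using p_gt_2 by (cases "n = 0") (auto simp: vabs_of_int field_simps)

lemma vabs_of_nat_le_1: "vabs (of_nat n :: 'a) \<le> 1"
  using vabs_of_int_le_1[of "int n"] by simp

lemma vabs_p: "vabs (of_nat p :: 'a) = 1 / p"
proof -
  have "multiplicity (int p) (int p) = 1"
    by (rule multiplicity_self) (use prime_p in auto)
  then show ?thesis
    using vabs_of_int[of "int p"] p_gt_2 by simp
qed

lemma vabs_of_int_dvd:
  assumes "int p dvd n"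
  shows "vabs (of_int n :: 'a) \<le> 1 / p"
proof -
  obtain m where "n = int p * m"
    using assms by blast
  then show ?thesis
    using vabs_of_int_le_1[of m] p_pos by (simp add: vabs_mult vabs_p divide_right_mono)
qed

lemma vabs_of_int_not_dvd: "\<not> int p dvd n \<Longrightarrow> vabs (of_int n :: 'a) = 1"
  by (cases "n = 0") (simp_all add: vabs_of_int not_dvd_imp_multiplicity_0)

lemma vabs_of_nat_not_dvd: "\<not> p dvd n \<Longrightarrow> vabs (of_nat n :: 'a) = 1"
  using vabs_of_int_not_dvd[of "int n"] by simp

lemma vabs_Fermat_int: "vabs (of_int n ^ p - of_int n :: 'a) \<le> 1 / p"
proof -
  have "int p dvd n ^ p - n"
  proof (cases "int p dvd n")
    case False
    \<comment> \<open>\<open>fermat_theorem\<close> speaks about natural numbers, so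
      \<open>n\<close> is replaced by its nonnegative residue.\<close>
    define m where "m = nat (n mod int p)"
    have m: "[int m = n] (mod int p)"
      using p_pos by (simp add: m_def cong_def)
    then have "\<not> p dvd m"
      using False cong_dvd_iff[OF m] by simp
    then have "[m ^ (p - 1) = 1] (mod p)"
      using fermat_theorem prime_p by blast
    then have "[int m ^ (p - 1) = 1] (mod int p)"
      by (simp flip: cong_int_iff)
    then have "[n ^ (p - 1) = 1] (mod int p)"
      using cong_pow[OF m] cong_sym cong_trans by blast
    then have "[n * n ^ (p - 1) = n * 1] (mod int p)"
      by (rule cong_scalar_left)
    moreover have "n * n ^ (p - 1) = n ^ p"
      using power_minus_mult[of p n] p_gt_2 by (simp add: mult.commute)
    ultimately show ?thesis
      by (simp add: cong_iff_dvd_diff)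
  next
    case True
    then show ?thesis
      using p_gt_2 by (intro dvd_diff dvd_trans[OF True] dvd_power) auto
  qed
  from vabs_of_int_dvd[OF this] show ?thesis
    by simp
qed

lemma vabs_of_rat_eq_powi:
  assumes "q \<noteq> 0"
  obtains n where "vabs (of_rat q :: 'a) = real p powi n"
proof -
  obtain a b where q: "q = Rat.Fract a b" "b > 0"
    by (cases q)
  with assms have a: "a \<noteq> 0"
    by (auto simp: rat_number_collapse)
  define i where "i = multiplicity (int p) a"
  define j where "j = multiplicity (int p) b"
  have "vabs (of_rat q :: 'a) = real p ^ j / real p ^ i"
    using q a vabs_of_int[of a] vabs_of_int[of b] by (simp add: of_rat_rat vabs_divide i_def j_def)
  also have "\<dots> = real p powi (int j - int i)"
    using p_pos by (simp add: power_int_diff)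
  finally show ?thesis
    using that by blast
qed

text \<open>In lowest terms a \<open>p\<close>-integral fraction \<open>a / b\<close> has a unit as
  denominator, and the congruences for \<open>a\<close> and \<open>b\<close> combine to one for the
  quotient.\<close>

lemma vabs_Fermat_rat:
  assumes "vabs (of_rat q :: 'a) \<le> 1"
  shows "vabs (of_rat q ^ p - of_rat q :: 'a) \<le> 1 / p"
proof -
  obtain a b where q: "quotient_of q = (a, b)"
    by fastforce
  let ?a = "of_int a :: 'a" and ?b = "of_int b :: 'a"
  have ab: "of_rat q = ?a / ?b" "b > 0" "coprime a b"
    using quotient_of_div[OF q] quotient_of_denom_pos[OF q] quotient_of_coprime[OF q]
    by (simp_all add: of_rat_divide)
  \<comment> \<open>If \<open>p\<close> divided \<open>b\<close>, it would not divide
    \<open>a\<close>, and the fraction would have absolute value greater than 1.\<close>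
  have b: "vabs ?b = 1"
  proof (cases "int p dvd b")
    case True
    then have "\<not> int p dvd a"
      using ab(3) prime_p coprime_common_divisor[of a b "int p"] by auto
    then have "vabs ?a = 1"
      by (rule vabs_of_int_not_dvd)
    moreover have "vabs ?b \<le> 1 / p"
      using True by (rule vabs_of_int_dvd)
    then have "vabs ?b < 1"
      using p_gt_2 by (auto elim: le_less_trans)
    moreover have "?b \<noteq> 0"
      using ab(2) by simp
    ultimately show ?thesis
      using assms by (simp add: ab(1) vabs_divide)
  qed (rule vabs_of_int_not_dvd)
  have "of_rat q ^ p - of_rat q = (?a ^ p - ?a) / ?b ^ p - ?a / ?b * ((?b ^ p - ?b) / ?b ^ p)"
    using ab(2) unfolding ab(1) by (simp add: power_divide divide_simps) (simp add: algebra_simps)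
  also have "vabs \<dots> \<le> 1 / p"
    using vabs_Fermat_int[of a] mult_mono[OF vabs_of_int_le_1[of a] vabs_Fermat_int[of b]]
    by (intro vabs_diff_le) (simp_all add: vabs_divide vabs_mult vabs_power b)
  finally show ?thesis .
qed

section \<open>Closure properties of \<open>Qp\<close> and its discrete values\<close>

lemma of_rat_in_Qp: "of_rat q \<in> (Qp :: 'a set)"
  unfolding Qp_def by (rule subsetD[OF closure_subset rangeI])

lemma of_nat_in_Qp: "of_nat n \<in> (Qp :: 'a set)"
  using of_rat_in_Qp[of "of_nat n"] by simp

lemma Qp_approx:
  assumes "x \<in> (Qp :: 'a set)" "e > 0"
  obtains q where "vabs (x - of_rat q) < e"
proof -
  obtain y where "y \<in> range of_rat" "dist y x < e"
    using assms unfolding Qp_def closure_approachable by blast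
  then show ?thesis
    using that by (auto simp: dist_vabs vabs_minus_commute)
qed

lemma Qp_diff:
  assumes "x \<in> (Qp :: 'a set)" "y \<in> Qp"
  shows "x - y \<in> Qp"
proof -
  obtain X Y where XY: "\<And>n. X n \<in> range of_rat" "X \<longlonglongrightarrow> x" "\<And>n. Y n \<in> range of_rat" "Y \<longlonglongrightarrow> y"
    using assms unfolding Qp_def closure_sequential by blast
  have "\<forall>n. X n - Y n \<in> range of_rat"
  proof
    fix n
    show "X n - Y n \<in> range of_rat"
      using XY(1)[of n] XY(3)[of n] by (auto simp flip: of_rat_diff)
  qed
  moreover have "(\<lambda>n. X n - Y n) \<longlonglongrightarrow> x - y"
    by (intro tendsto_diff XY)
  ultimately show ?thesis
    unfolding Qp_def closure_sequential by (intro exI conjI)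
qed

lemma Qp_add: "x \<in> (Qp :: 'a set) \<Longrightarrow> y \<in> Qp \<Longrightarrow> x + y \<in> Qp"
  using Qp_diff[of x "of_rat 0 - y"] Qp_diff[of "of_rat 0" y] of_rat_in_Qp[of 0] by simp

lemma Qp_mult:
  assumes "x \<in> (Qp :: 'a set)" "y \<in> Qp"
  shows "x * y \<in> Qp"
proof -
  obtain X Y where XY: "\<And>n. X n \<in> range of_rat" "X \<longlonglongrightarrow> x" "\<And>n. Y n \<in> range of_rat" "Y \<longlonglongrightarrow> y"
    using assms unfolding Qp_def closure_sequential by blast
  have "\<forall>n. X n * Y n \<in> range of_rat"
  proof
    fix n
    show "X n * Y n \<in> range of_rat"
      using XY(1)[of n] XY(3)[of n] by (auto simp flip: of_rat_mult)
  qed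
  moreover have "(\<lambda>n. X n * Y n) \<longlonglongrightarrow> x * y"
    by (intro tendsto_mult XY)
  ultimately show ?thesis
    unfolding Qp_def closure_sequential by (intro exI conjI)
qed

lemma Qp_divide_p_powi:
  assumes "x \<in> (Qp :: 'a set)"
  shows "x / of_nat p powi n \<in> Qp"
proof -
  have "of_rat (1 / of_nat p powi n) = (1 / of_nat p powi n :: 'a)"
    by (simp add: of_rat_divide power_int_def of_rat_power of_rat_inverse)
  then show ?thesis
    using Qp_mult[OF assms of_rat_in_Qp, of "1 / of_nat p powi n"] by simp
qed

lemma Qp_power: "x \<in> (Qp :: 'a set) \<Longrightarrow> x ^ n \<in> Qp"
  using of_rat_in_Qp[of 1] by (induction n) (auto intro: Qp_mult)

text \<open>A rational closer to \<open>x\<close> than \<open>vabs x\<close> has the same absolute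
  value as \<open>x\<close>, so completion adds no new values.\<close>

lemma Qp_vabs_eq_powi:
  assumes "x \<in> (Qp :: 'a set)" "x \<noteq> 0"
  obtains n where "vabs x = real p powi n"
proof -
  obtain q where q: "vabs (x - of_rat q) < vabs x"
    using Qp_approx[OF assms(1), of "vabs x"] assms(2) by auto
  then have "vabs (of_rat q :: 'a) = vabs x"
    by (rule vabs_eqI)
  moreover from this have "q \<noteq> 0"
    using assms by auto
  ultimately show ?thesis
    using vabs_of_rat_eq_powi that by metis
qed

text \<open>The exponent exists by discreteness and is unique because powers of \<open>p\<close>
  increase strictly; hence the description in \<open>padic_val\<close> denotes it.\<close>

lemma vabs_eq_padic_val:
  assumes "x \<in> (Qp :: 'a set)" "x \<noteq> 0"
  shows "vabs x = real p powi (- padic_val p x)"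
proof -
  obtain n where n: "vabs x = real p powi n"
    using Qp_vabs_eq_powi assms .
  show ?thesis
    unfolding padic_val_def
  proof (rule theI)
    show "vabs x = real p powi (- (- n))"
      using n by simp
    show "m = - n" if "vabs x = real p powi (- m)" for m
    proof -
      have "\<not> - m < n" "\<not> n < - m"
        using that n power_int_strict_increasing[of "- m" n "real p"]
          power_int_strict_increasing[of n "- m" "real p"] p_gt_2 by auto
      then show ?thesis
        by linarith
    qed
  qed
qed

text \<open>Approximate \<open>x\<close> by a rational to within \<open>1 / p\<close>; on the unit
  ball the \<open>p\<close>-th power does not increase distances, so the congruence carries
  over.\<close>

lemma vabs_Fermat:
  assumes "x \<in> (Qp :: 'a set)" "vabs x \<le> 1"
  shows "vabs (x ^ p - x) \<le> 1 / p"
proof -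
  obtain q where q: "vabs (x - of_rat q) < 1 / p"
    using Qp_approx[OF assms(1), of "1 / p"] p_pos by auto
  then have "vabs (x - of_rat q) \<le> 1"
    using p_gt_2 by (auto elim!: order.trans[OF less_imp_le])
  then have q1: "vabs (of_rat q :: 'a) \<le> 1"
    using vabs_diff_le[OF assms(2), of "x - of_rat q"] by simp
  have "vabs (x ^ p - of_rat q ^ p) \<le> vabs (x - of_rat q)"
    using vabs_power_diff_le[of "of_rat q" 1 x p] q1 assms(2) by simp
  then show ?thesis
    using vabs_diff_trans[of "x ^ p" "of_rat q ^ p" "1 / p" x]
      vabs_diff_trans[of "of_rat q ^ p" "of_rat q" "1 / p" x]
      vabs_Fermat_rat[OF q1] q vabs_minus_commute[of x "of_rat q"] by simp
qed

section \<open>Teichmueller representatives\<close>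

text \<open>
  In \<open>z ^ p - w ^ p = (z - w) * (\<Sum>i<p. \<dots>)\<close> the second factor is congruent to \<open>p * w ^ (p - 1)\<close>
  modulo \<open>z - w\<close>, which gives the extra factor \<open>1 / p\<close>.
\<close>
lemma vabs_power_p_diff_le:
  fixes z w :: 'a
  assumes "vabs z \<le> 1" "vabs w \<le> 1" "vabs (z - w) \<le> 1 / p"
  shows "vabs (z ^ p - w ^ p) \<le> vabs (z - w) / p"
proof -
  have pow: "vabs (z ^ i - w ^ i) \<le> 1 / p" for i
    using vabs_power_diff_le[of w 1 z i] assms by simp
  have "(\<Sum>i<p. w ^ (p - Suc i) * z ^ i) = (\<Sum>i<p. w ^ (p - Suc i) * (z ^ i - w ^ i)) + of_nat p * w ^ (p - 1)"
    by (simp add: sum_subtractf right_diff_distrib flip: power_add)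
  also have "vabs \<dots> \<le> 1 / p"
  proof (intro vabs_add_le vabs_sum_le)
    show "vabs (w ^ (p - Suc i) * (z ^ i - w ^ i)) \<le> 1 / p" for i
      using mult_mono[OF power_le_one[OF _ assms(2), of "p - Suc i"] pow[of i]]
      by (simp add: vabs_mult vabs_power)
    show "vabs (of_nat p * w ^ (p - 1)) \<le> 1 / p"
      using mult_left_mono[OF power_le_one[OF _ assms(2), of "p - 1"], of "1 / p"]
      by (simp add: vabs_mult vabs_power vabs_p)
  qed simp
  finally have "vabs (z - w) * vabs (\<Sum>i<p. w ^ (p - Suc i) * z ^ i) \<le> vabs (z - w) * (1 / p)"
    by (rule mult_left_mono) simp
  then show ?thesis
    by (simp add: power_diff_sumr2 vabs_mult)
qed

text \<open>Translates the congruence modulo \<open>p\<close> in the definition of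
  \<open>teichmueller\<close> into an inequality that the ultrametric estimates can handle.\<close>

lemma ex_Zp_p_mult_iff:
  assumes "x \<in> (Qp :: 'a set)"
  shows "(\<exists>z\<in>Zp. x = of_nat p * z) \<longleftrightarrow> vabs x \<le> 1 / p"
proof
  assume "vabs x \<le> 1 / p"
  moreover have "x / of_nat p \<in> Qp"
    using Qp_divide_p_powi[OF assms, of 1] by simp
  ultimately show "\<exists>z\<in>Zp. x = of_nat p * z"
    using p_gt_2 by (intro bexI[of _ "x / of_nat p"]) (auto simp: Zp_def vabs_divide vabs_p field_simps)
qed (use p_pos in \<open>auto simp: Zp_def vabs_mult vabs_p field_simps\<close>)

lemma vabs_root_of_unity:
  assumes "w ^ (p - 1) = 1"
  shows "vabs (w :: 'a) = 1"
proof -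
  have "vabs w ^ (p - 1) = 1 ^ (p - 1)"
    using assms vabs_power[of w "p - 1"] by simp
  then show ?thesis
    by (rule power_eq_imp_eq_base) (use p_gt_2 in auto)
qed

text \<open>Existence: the iterated \<open>p\<close>-th powers of \<open>u\<close> converge, since
  by Fermat the first step is at most \<open>1 / p\<close> and each later step gains another factor
  \<open>1 / p\<close>. Uniqueness: two candidates are congruent modulo \<open>p\<close> and fixed
  by the \<open>p\<close>-th power, so their distance is at most \<open>1 / p\<close> times
  itself.\<close>

lemma teichmueller_ex1:
  assumes "u \<in> (Qp :: 'a set)" "vabs u = 1"
  shows "\<exists>!w. w \<in> Zp \<and> w ^ (p - 1) = 1 \<and> (\<exists>z\<in>Zp. w - u = of_nat p * z)"
proof (rule ex_ex1I)
  define X where "X n = u ^ (p ^ n)" for n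
  have X_Suc: "X (Suc n) = X n ^ p" for n
    by (simp add: X_def mult.commute flip: power_mult)
  have X: "vabs (X n) = 1" "X n \<in> Qp" for n
    by (simp_all add: X_def vabs_power assms Qp_power)
  have diff: "vabs (X (Suc n) - X n) \<le> (1 / p) ^ Suc n" for n
  proof (induction n)
    case 0
    show ?case
      using vabs_Fermat[OF assms(1)] assms(2) by (simp add: X_def)
  next
    case (Suc n)
    \<comment> \<open>The contraction estimate \<open>vabs_power_p_diff_le\<close> applies only to
      points at distance at most \<open>1 / p\<close>.\<close>
    have "(1 / real p) ^ Suc n \<le> (1 / p) ^ 1"
      using p_gt_2 by (intro power_decreasing) auto
    then have "vabs (X (Suc n) - X n) \<le> 1 / p"
      using Suc by simp
    then have "vabs (X (Suc (Suc n)) - X (Suc n)) \<le> vabs (X (Suc n) - X n) / p"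
      using vabs_power_p_diff_le[of "X (Suc n)" "X n"] X(1) by (simp flip: X_Suc)
    also have "\<dots> \<le> (1 / p) ^ Suc (Suc n)"
      using divide_right_mono[OF Suc, of "real p"] by simp
    finally show ?case .
  qed
  have "(\<lambda>n. (1 / real p) ^ Suc n) \<longlonglongrightarrow> 0"
    using p_gt_2 by (intro LIMSEQ_Suc LIMSEQ_realpow_zero) auto
  then have "(\<lambda>n. X (Suc n) - X n) \<longlonglongrightarrow> 0"
    by (rule tendsto_0_if_vabs_le[OF diff])
  then obtain w where w: "X \<longlonglongrightarrow> w"
    using convergent_if_diff_tendsto_0 convergent_def by blast
  \<comment> \<open>The limit of \<open>X (Suc n) = X n ^ p\<close> gives \<open>w ^ p = w\<close>;
    cancelling \<open>w\<close>, which is nonzero since \<open>vabs w = 1\<close>, yields the root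
    of unity equation.\<close>
  have "(\<lambda>n. X n ^ p) \<longlonglongrightarrow> w ^ p"
    by (rule tendsto_power_strong[OF w tendsto_const])
  then have wp: "w ^ p = w"
    using LIMSEQ_Suc[OF w] LIMSEQ_unique by (simp add: X_Suc)
  have "(\<lambda>n. vabs (X n)) \<longlonglongrightarrow> vabs w"
    by (rule tendsto_vabs[OF w])
  then have vw: "vabs w = 1"
    by (simp add: X LIMSEQ_const_iff)
  have "w ^ (p - 1) * w = 1 * w"
    using wp power_minus_mult[of p w] p_gt_2 by simp
  moreover have "w \<noteq> 0"
    using vw by auto
  ultimately have "w ^ (p - 1) = 1"
    by simp
  moreover have wQ: "w \<in> Qp"
    using closed_sequentially[OF closed_closure[of "range of_rat :: 'a set", folded Qp_def] _ w] X(2) by blast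
  moreover have "vabs (X n - u) \<le> 1 / p" for n
  proof (induction n)
    case (Suc n)
    have "(1 / real p) ^ Suc n \<le> (1 / p) ^ 1"
      using p_gt_2 by (intro power_decreasing) auto
    then show ?case
      using diff[of n] vabs_diff_trans[OF _ Suc, of "X (Suc n)"] by simp
  qed (simp add: X_def)
  then have "vabs (w - u) \<le> 1 / p"
    by (rule vabs_lim_le[OF tendsto_diff[OF w tendsto_const]])
  ultimately show "\<exists>w. w \<in> Zp \<and> w ^ (p - 1) = 1 \<and> (\<exists>z\<in>Zp. w - u = of_nat p * z)"
    using vw ex_Zp_p_mult_iff[OF Qp_diff[OF wQ assms(1)]] by (intro exI[of _ w]) (simp add: Zp_def)
next
  fix v w
  assume v: "v \<in> Zp \<and> v ^ (p - 1) = 1 \<and> (\<exists>z\<in>Zp. v - u = of_nat p * z)"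
    and w: "w \<in> Zp \<and> w ^ (p - 1) = 1 \<and> (\<exists>z\<in>Zp. w - u = of_nat p * z)"
  have "v ^ p = v" "w ^ p = w"
    using v w power_minus_mult[of p v] power_minus_mult[of p w] p_gt_2 by simp_all
  moreover have "vabs (v - w) \<le> 1 / p"
    using v w ex_Zp_p_mult_iff Qp_diff[OF _ assms(1)] vabs_diff_trans[of v u "1 / p" w]
    by (auto simp: Zp_def vabs_minus_commute[of u w])
  ultimately have "vabs (v - w) \<le> vabs (v - w) / p"
    using vabs_power_p_diff_le[of v w] v w by (simp add: Zp_def)
  moreover have "vabs (v - w) / p < vabs (v - w) / 1" if "vabs (v - w) > 0"
    using that p_gt_2 by (intro divide_strict_left_mono) auto
  ultimately have "\<not> vabs (v - w) > 0"
    by fastforce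
  then show "v = w"
    by simp
qed

lemma teichmueller_props:
  assumes "u \<in> (Qp :: 'a set)" "vabs u = 1"
  shows "vabs (teichmueller p u - u) \<le> 1 / p" "vabs (teichmueller p u) = 1"
    and "teichmueller p u \<noteq> 0"
proof -
  let ?w = "teichmueller p u"
  have w: "?w \<in> Zp \<and> ?w ^ (p - 1) = 1 \<and> (\<exists>z\<in>Zp. ?w - u = of_nat p * z)"
    unfolding teichmueller_def by (rule theI'[OF teichmueller_ex1[OF assms]])
  then show "vabs (?w - u) \<le> 1 / p"
    using ex_Zp_p_mult_iff[OF Qp_diff[OF _ assms(1)], of ?w] by (simp add: Zp_def)
  show "vabs ?w = 1"
    using w vabs_root_of_unity by blast
  then show "?w \<noteq> 0"
    by auto
qed

text \<open>Congruence modulo \<open>p\<close> is transitive, so both descriptions select by the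
  same predicate.\<close>

lemma teichmueller_cong:
  assumes "u \<in> (Qp :: 'a set)" "v \<in> Qp" "vabs (u - v) \<le> 1 / p"
  shows "teichmueller p u = teichmueller p v"
proof -
  have "(\<exists>z\<in>Zp. w - u = of_nat p * z) \<longleftrightarrow> (\<exists>z\<in>Zp. w - v = of_nat p * z)" if "w \<in> Zp" for w
    using that ex_Zp_p_mult_iff[OF Qp_diff[OF _ assms(1)], of w]
      ex_Zp_p_mult_iff[OF Qp_diff[OF _ assms(2)], of w]
      vabs_diff_trans[of w u "1 / p" v] vabs_diff_trans[of w v "1 / p" u] assms(3)
    by (auto simp: Zp_def vabs_minus_commute[of v u])
  then show ?thesis
    unfolding teichmueller_def by meson
qed

section \<open>The character \<open>omega_v\<close>, its local constancy, and the projection\<close>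

lemma omega_v_eq:
  fixes y :: 'a
  assumes "y \<noteq> 0"
  shows "omega_v p y = of_nat p powi padic_val p y * teichmueller p (y / of_nat p powi padic_val p y)"
  using assms p_gt_2 by (simp add: omega_v_def angle_proj_def Let_def)

lemma vabs_unit_part:
  assumes "y \<in> (Qp :: 'a set)" "y \<noteq> 0"
  shows "vabs (y / of_nat p powi padic_val p y) = 1"
  using vabs_eq_padic_val[OF assms] p_pos
  by (simp add: vabs_divide vabs_power_int vabs_p power_int_divide_distrib power_int_minus divide_simps)

lemma omega_v_props:
  assumes "y \<in> (Qp :: 'a set)" "y \<noteq> 0"
  shows "omega_v p y \<noteq> 0" "vabs (omega_v p y) = vabs y"
    and "angle_proj p y = y / omega_v p y" "vabs (angle_proj p y - 1) \<le> 1 / p"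
proof -
  define P where "P = (of_nat p powi padic_val p y :: 'a)"
  define w where "w = teichmueller p (y / P)"
  have P: "P \<noteq> 0" "y / P \<in> Qp" "vabs (y / P) = 1"
    using p_gt_2 assms Qp_divide_p_powi vabs_unit_part by (simp_all add: P_def)
  have w: "vabs (w - y / P) \<le> 1 / p" "vabs w = 1" "w \<noteq> 0"
    unfolding w_def using teichmueller_props[OF P(2,3)] by blast+
  have o: "omega_v p y = P * w"
    using omega_v_eq[OF assms(2)] by (simp add: P_def w_def)
  show "omega_v p y \<noteq> 0"
    using o P(1) w(3) by simp
  show "vabs (omega_v p y) = vabs y"
    using P(3) w(2) P(1) by (simp add: o vabs_mult vabs_divide divide_eq_eq)
  show a: "angle_proj p y = y / omega_v p y"
    using assms P(1) w(3) by (simp add: omega_v_def)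
  have "angle_proj p y - 1 = (y / P - w) / w"
    unfolding a o using P(1) w(3) by (simp add: field_simps)
  then show "vabs (angle_proj p y - 1) \<le> 1 / p"
    using w by (simp add: vabs_divide vabs_minus_commute[of _ w])
qed

text \<open>By the isosceles principle \<open>x\<close> and \<open>y\<close> have the same
  valuation. Divided by the same power of \<open>p\<close>, they become congruent modulo
  \<open>p\<close> and share a Teichmueller representative.\<close>

lemma omega_v_cong:
  assumes "x \<in> (Qp :: 'a set)" "y \<in> Qp" "x \<noteq> 0" "vabs (x - y) \<le> vabs x / p"
  shows "omega_v p y = omega_v p x"
proof -
  have "vabs x / p < vabs x"
    using assms(3) p_gt_2 by (simp add: field_simps)
  then have eq: "vabs y = vabs x"
    using assms(4) by (intro vabs_eqI) simp
  then have y: "y \<noteq> 0"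
    using assms(3) by auto
  define P where "P = (of_nat p powi padic_val p x :: 'a)"
  have val: "padic_val p y = padic_val p x"
    by (simp add: padic_val_def eq)
  have "vabs (x / P) = 1"
    using vabs_unit_part assms by (simp add: P_def)
  then have "vabs P = vabs x"
    using assms(3) by (simp add: vabs_divide)
  then have "vabs (x / P - y / P) \<le> 1 / p"
    using assms(3,4) by (simp add: vabs_divide field_simps flip: diff_divide_distrib)
  then show ?thesis
    using teichmueller_cong[of "x / P" "y / P"] Qp_divide_p_powi assms y
    by (simp add: omega_v_eq val P_def)
qed

text \<open>Values on \<open>Qp\<close> are integral powers of \<open>p\<close>, so the first one
  above 1 is \<open>p\<close> itself.\<close>

lemma Qp_minus_Zp_vabs_ge:
  assumes "x \<in> (Qp - Zp :: 'a set)"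
  shows "vabs x \<ge> p"
proof -
  have x: "x \<in> Qp" "vabs x > 1"
    using assms by (auto simp: Zp_def)
  have "x \<noteq> 0"
    using x(2) by auto
  then obtain n where n: "vabs x = real p powi n"
    using Qp_vabs_eq_powi[OF x(1)] by blast
  have "n > 0"
  proof (rule ccontr)
    assume "\<not> n > 0"
    then have "real p powi n \<le> real p powi 0"
      using p_gt_2 by (intro power_int_increasing) auto
    then show False
      using x n by simp
  qed
  then have "real p powi 1 \<le> real p powi n"
    using p_gt_2 by (intro power_int_increasing) auto
  then show ?thesis
    using n by simp
qed

text \<open>As \<open>vabs x\<close> is at least \<open>p\<close>, a shift of size at most 1 has
  relative size at most \<open>1 / p\<close>, the precision at which \<open>omega_v\<close> is
  constant.\<close>

lemma angle_proj_near:
  assumes "x \<in> (Qp - Zp :: 'a set)" "y \<in> Qp" "vabs (y - x) \<le> 1"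
  shows "omega_v p y = omega_v p x" "angle_proj p y = y / omega_v p x" "y \<noteq> 0" "y \<in> Qp - Zp"
    and "vabs (y / omega_v p x - 1) \<le> 1 / p"
proof -
  have vx: "vabs x \<ge> p"
    using Qp_minus_Zp_vabs_ge assms(1) .
  then have x: "x \<in> Qp" "x \<noteq> 0"
    using assms(1) p_pos by auto
  have "vabs y = vabs x"
    using vx assms(3) p_gt_2 by (intro vabs_eqI) (simp add: vabs_minus_commute)
  then have vy: "vabs y \<ge> p"
    using vx by simp
  then show y: "y \<noteq> 0" "y \<in> Qp - Zp"
    using p_gt_2 assms(2) by (auto simp: Zp_def)
  have "1 \<le> vabs x / p"
    using vx p_pos by simp
  then show *: "omega_v p y = omega_v p x"
    using assms x by (intro omega_v_cong) (auto simp: vabs_minus_commute)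
  show "angle_proj p y = y / omega_v p x" "vabs (y / omega_v p x - 1) \<le> 1 / p"
    using omega_v_props(3,4)[OF assms(2) y(1)] by (simp_all add: *)
qed

end


section \<open>Binomial series\<close>

text \<open>The power of \<open>1 + z\<close> with exponent \<open>t\<close>, separated from
  \<open>angle_proj\<close> so that it can be studied as a function of \<open>z\<close>.\<close>

definition binom_series :: "'a::ultrametric_field \<Rightarrow> 'a \<Rightarrow> 'a" where
  "binom_series t z = (\<Sum>k. (t gchoose k) * z ^ k)"

section \<open>Legendre's bound and the size of binomial coefficients\<close>

context padic_field
begin

text \<open>Only the multiples of \<open>p\<close> contribute to the product; taking one factor
  \<open>p\<close> out of each of the \<open>n div p\<close> multiples leaves a smaller
  factorial.\<close>

lemma vabs_fact_eq: "vabs (fact n :: 'a) = (1 / p) ^ (n div p) * vabs (fact (n div p) :: 'a)"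
proof -
  have fact: "vabs (fact m :: 'a) = (\<Prod>i\<in>{1..m}. vabs (of_nat i :: 'a))" for m
    by (simp add: fact_prod vabs_prod)
  have "(\<Prod>i\<in>{1..n}. vabs (of_nat i :: 'a)) = (\<Prod>i\<in>(*) p ` {1..n div p}. vabs (of_nat i :: 'a))"
  proof (rule prod.mono_neutral_right)
    show "(*) p ` {1..n div p} \<subseteq> {1..n}"
      using p_gt_2 by (auto simp: less_eq_div_iff_mult_less_eq mult.commute)
    have "i \<in> (*) p ` {1..n div p}" if "i \<in> {1..n}" "p dvd i" for i
      using that p_gt_2
      by (intro image_eqI[of _ _ "i div p"]) (auto simp: div_le_mono Suc_le_eq div_greater_zero_iff dvd_imp_le)
    then show "\<forall>i\<in>{1..n} - (*) p ` {1..n div p}. vabs (of_nat i :: 'a) = 1"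
      using vabs_of_nat_not_dvd by blast
  qed simp
  also have "\<dots> = (\<Prod>i\<in>{1..n div p}. vabs (of_nat p :: 'a) * vabs (of_nat i :: 'a))"
    using p_gt_2 by (subst prod.reindex) (auto simp: inj_on_def vabs_mult)
  also have "\<dots> = (1 / p) ^ (n div p) * vabs (fact (n div p) :: 'a)"
    unfolding prod.distrib fact by (simp add: vabs_p)
  finally show ?thesis
    by (simp only: fact)
qed

text \<open>Legendre's bound \<open>v(n!) \<le> n / (p - 1)\<close>, with \<open>c = p ^ (1 / (p - 1))\<close>.\<close>

lemma vabs_fact_ge:
  assumes "c \<ge> 1" "c ^ (p - 1) = real p"
  shows "1 \<le> vabs (fact n :: 'a) * c ^ n"
proof (induction n rule: less_induct)
  case (less n)
  show ?case
  proof (cases "n = 0")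
    case False
    define q where "q = n div p"
    have "q < n"
      using False p_gt_2 by (simp add: q_def)
    then have "1 \<le> vabs (fact q :: 'a) * c ^ q"
      by (rule less)
    \<comment> \<open>Insert \<open>1 = (1 / p) ^ q * (c ^ (p - 1)) ^ q\<close>. The powers of
      \<open>c\<close> then combine to the exponent \<open>p * q\<close>, which is at most
      \<open>n\<close>.\<close>
    also have "\<dots> = vabs (fact q :: 'a) * (1 / p) ^ q * ((c ^ (p - 1)) ^ q * c ^ q)"
      unfolding assms(2) using p_pos by (simp add: power_one_over)
    also have "(c ^ (p - 1)) ^ q * c ^ q = c ^ (p * q)"
      using power_minus_mult[of p c] p_gt_2 by (simp add: power_mult flip: power_mult_distrib)
    also have "vabs (fact q :: 'a) * (1 / p) ^ q * c ^ (p * q) \<le> vabs (fact q :: 'a) * (1 / p) ^ q * c ^ n"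
      using assms(1) by (intro mult_left_mono power_increasing) (auto simp: q_def)
    also have "\<dots> = vabs (fact n :: 'a) * c ^ n"
      by (simp add: vabs_fact_eq[of n] q_def)
    finally show ?thesis .
  qed simp
qed

text \<open>Each numerator factor is at most \<open>M\<close>, and dividing by the factorial costs
  at most \<open>c ^ k\<close>. The radius satisfies \<open>R_p p * c = p\<close>, which leaves a
  strict gap \<open>M * c < p\<close>; this gap makes the series converge up to
  \<open>vabs z = 1 / p\<close>.\<close>

lemma gbinomial_bound:
  assumes "vabs (t :: 'a) < R_p p"
  obtains \<rho> :: real where "0 \<le> \<rho>" "\<rho> < 1" "\<And>k. vabs (t gchoose k) \<le> (real p * \<rho>) ^ k"
proof -
  define c where "c = real p powr (1 / (p - 1))"
  define M where "M = max 1 (vabs t)"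
  have c: "c \<ge> 1" "c ^ (p - 1) = real p"
    using p_gt_2 by (simp_all add: c_def ge_one_powr_ge_zero powr_powr flip: powr_realpow)
  \<comment> \<open>Needed for the case \<open>M = 1\<close>; it relies on
    \<open>p > 2\<close>.\<close>
  have "c < p powr 1"
    unfolding c_def using p_gt_2 by (intro powr_less_mono) auto
  moreover have "R_p p * c = p powr ((real p - 2) / (real p - 1) + 1 / (real p - 1))"
    unfolding R_p_def c_def using p_gt_2 by (simp add: powr_add of_nat_diff)
  then have "R_p p * c = p"
    using p_gt_2 by (simp flip: add_divide_distrib)
  then have "vabs t * c < p"
    using assms c(1) mult_strict_right_mono[of "vabs t" "R_p p" c] by simp
  ultimately have Mc: "M * c < p"
    using p_pos by (simp add: M_def max_def)
  have "vabs (t gchoose k) \<le> (M * c) ^ k" for k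
  proof -
    have "vabs (t gchoose k) = (\<Prod>i = 0..<k. vabs (t - of_nat i)) / vabs (fact k :: 'a)"
      by (simp add: gbinomial_prod_rev vabs_divide vabs_prod)
    also have "\<dots> \<le> (\<Prod>i = 0..<k. M) / vabs (fact k :: 'a)"
    proof (intro divide_right_mono prod_mono conjI)
      show "vabs (t - of_nat i) \<le> M" for i
        using vabs_of_nat_le_1[of i] by (intro vabs_diff_le) (auto simp: M_def)
    qed simp_all
    also have "\<dots> \<le> M ^ k * c ^ k"
      using mult_left_mono[OF vabs_fact_ge[OF c, of k], of "M ^ k"] by (simp add: M_def field_simps)
    finally show ?thesis
      by (simp add: power_mult_distrib)
  qed
  then show thesis
    using Mc c p_pos by (intro that[of "M * c / p"]) (auto simp: M_def)
qed

lemma vabs_gbinomial_le: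
  assumes "vabs (t :: 'a) < R_p p"
  shows "vabs (t gchoose k) \<le> real p ^ k"
proof -
  obtain \<rho> where \<rho>: "0 \<le> \<rho>" "\<rho> < 1" "\<And>k. vabs (t gchoose k) \<le> (real p * \<rho>) ^ k"
    using gbinomial_bound[OF assms] by blast
  have "(real p * \<rho>) ^ k \<le> real p ^ k"
    using \<rho> p_pos by (intro power_mono) (auto simp: mult_le_cancel_left1)
  then show ?thesis
    using \<rho>(3) order_trans by blast
qed

lemma R_p_gt_1: "1 < R_p p"
  unfolding R_p_def using p_gt_2 by (intro gr_one_powr) auto

lemma vabs_of_int_less_R_p: "vabs (of_int n :: 'a) < R_p p"
  using vabs_of_int_le_1 R_p_gt_1 by (rule le_less_trans)

lemma vabs_diff_1_less_R_p: "vabs (t :: 'a) < R_p p \<Longrightarrow> vabs (t - 1) < R_p p"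
  using R_p_gt_1 by (intro le_less_trans[OF vabs_diff_le[of t "max 1 (vabs t)" 1]]) auto

section \<open>Convergence, functional equation and difference estimates of the binomial
  series\<close>

lemma binom_series_sums:
  assumes "vabs (t :: 'a) < R_p p" "vabs z \<le> 1 / p"
  shows "(\<lambda>k. (t gchoose k) * z ^ k) sums binom_series t z"
proof -
  obtain \<rho> where \<rho>: "0 \<le> \<rho>" "\<rho> < 1" "\<And>k. vabs (t gchoose k) \<le> (real p * \<rho>) ^ k"
    using gbinomial_bound[OF assms(1)] by blast
  have "vabs ((t gchoose k) * z ^ k) \<le> \<rho> ^ k" for k
    using mult_mono[OF \<rho>(3)[of k] power_mono[OF assms(2), of k]] \<rho>(1) p_pos
    by (simp add: vabs_mult vabs_power flip: power_mult_distrib)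
  moreover have "(\<lambda>k. \<rho> ^ k) \<longlonglongrightarrow> 0"
    using \<rho> by (intro LIMSEQ_realpow_zero)
  ultimately have "(\<lambda>k. (t gchoose k) * z ^ k) \<longlonglongrightarrow> 0"
    by (rule tendsto_0_if_vabs_le)
  then show ?thesis
    unfolding binom_series_def by (intro summable_sums ultrametric_summable)
qed

lemma binom_series_add_1:
  assumes "vabs (t :: 'a) < R_p p" "vabs (t + 1) < R_p p" "vabs z \<le> 1 / p"
  shows "binom_series (t + 1) z = (1 + z) * binom_series t z"
proof -
  have B: "(\<lambda>k. (t gchoose k) * z ^ k) sums binom_series t z"
    by (rule binom_series_sums[OF assms(1,3)])
  \<comment> \<open>The constant term 1 is split off so that Pascal's rule applies to every
    remaining index.\<close>
  then have "(\<lambda>k. (t gchoose Suc k) * z ^ Suc k) sums (binom_series t z - 1)"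
    using sums_tail by fastforce
  from sums_add[OF ultrametric_sums_mult[OF B, of z] this]
  have "(\<lambda>k. (t + 1 gchoose Suc k) * z ^ Suc k) sums (z * binom_series t z + (binom_series t z - 1))"
    unfolding gbinomial_Suc_Suc by (simp add: distrib_left distrib_right mult_ac)
  then have "(\<lambda>k. (t + 1 gchoose k) * z ^ k) sums (z * binom_series t z + (binom_series t z - 1) + 1)"
    using sums_Suc[of "\<lambda>k. (t + 1 gchoose k) * z ^ k"] by fastforce
  then show ?thesis
    using sums_unique2[OF binom_series_sums[OF assms(2,3)]] by (simp add: algebra_simps)
qed

text \<open>Induction in both directions from exponent 0; the downward step cancels
  \<open>1 + z\<close>, which is nonzero because \<open>vabs z < 1\<close>.\<close>

lemma binom_series_of_int:
  assumes "vabs (z :: 'a) \<le> 1 / p"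
  shows "binom_series (of_int n) z = (1 + z) powi n"
proof -
  have "vabs z < 1"
    using assms p_gt_2 by (auto elim!: le_less_trans)
  then have z: "1 + z \<noteq> 0"
    by (metis add_eq_0_iff less_irrefl vabs_1 vabs_minus)
  have step: "binom_series (of_int (i + 1)) z = (1 + z) * binom_series (of_int i) z" for i
    using binom_series_add_1[of "of_int i" z] vabs_of_int_less_R_p[of i] vabs_of_int_less_R_p[of "i + 1"] assms
    by simp
  show ?thesis
  proof (induction n rule: int_induct[where k = 0])
    case base
    have "(\<lambda>k. (0 gchoose k) * z ^ k) sums (0 + 1)"
      using sums_Suc[of "\<lambda>k. (0 gchoose k) * z ^ k" 0] by simp
    then show ?case
      by (simp add: binom_series_def sums_iff)
  next
    case (step1 i)
    then show ?case
      using step[of i] z by (simp add: power_int_add_1')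
  next
    case (step2 i)
    then show ?case
      using step[of "i - 1"] z power_int_add_1'[of "1 + z" "i - 1"] by simp
  qed
qed

text \<open>Termwise: the bound \<open>p ^ k\<close> for the coefficient cancels
  \<open>(1 / p) ^ k\<close> from the power difference at radius \<open>r = 1 / p\<close>, and
  dividing by \<open>r\<close> leaves the constant \<open>p\<close>.\<close>

lemma binom_series_lipschitz:
  assumes "vabs (t :: 'a) < R_p p" "vabs z \<le> 1 / p" "vabs z' \<le> 1 / p"
  shows "vabs (binom_series t z' - binom_series t z) \<le> p * vabs (z' - z)"
proof (rule vabs_sums_le)
  show "(\<lambda>k. (t gchoose k) * z' ^ k - (t gchoose k) * z ^ k) sums (binom_series t z' - binom_series t z)"
    by (intro ultrametric_sums_diff binom_series_sums assms)
  fix k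
  have "vabs ((t gchoose k) * z' ^ k - (t gchoose k) * z ^ k) = vabs (t gchoose k) * vabs (z' ^ k - z ^ k)"
    by (simp flip: vabs_mult right_diff_distrib)
  also have "\<dots> \<le> real p ^ k * (p * (vabs (z' - z) * (1 / p) ^ k))"
    using vabs_gbinomial_le[OF assms(1)] vabs_power_diff_le[OF assms(2,3), of k] p_pos
    by (intro mult_mono) (auto simp: field_simps)
  also have "\<dots> = p * vabs (z' - z)"
    using p_pos by (simp add: power_one_over)
  finally show "vabs ((t gchoose k) * z' ^ k - (t gchoose k) * z ^ k) \<le> p * vabs (z' - z)" .
qed

lemma binom_series_second_order:
  assumes "vabs (t :: 'a) < R_p p" "vabs z \<le> 1 / p" "vabs z' \<le> 1 / p"
  shows "vabs (binom_series t z' - binom_series t z - (z' - z) * t * binom_series (t - 1) z)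
           \<le> p\<^sup>2 * vabs (z' - z) ^ 2"
proof (rule vabs_sums_le)
  \<comment> \<open>The linear Taylor terms. By the absorption identity they sum to the derivative
    term with exponent \<open>t - 1\<close>; the shift of index is allowed since
    \<open>d 0 = 0\<close>.\<close>
  define d where "d k = (t gchoose k) * (of_nat k * (z' - z) * z ^ (k - 1))" for k
  have "d (Suc k) = (z' - z) * t * ((t - 1 gchoose k) * z ^ k)" for k
  proof -
    have "d (Suc k) = (z' - z) * (of_nat (Suc k) * (t gchoose Suc k)) * z ^ k"
      by (simp add: d_def mult_ac del: of_nat_Suc)
    then show ?thesis
      by (simp only: gbinomial_absorption mult_ac)
  qed
  then have "(\<lambda>k. d (Suc k)) sums ((z' - z) * t * binom_series (t - 1) z)"
    using ultrametric_sums_mult[OF binom_series_sums[OF vabs_diff_1_less_R_p[OF assms(1)] assms(2)], of "(z' - z) * t"]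
    by simp
  then have "d sums ((z' - z) * t * binom_series (t - 1) z)"
    using sums_Suc[of d] by (simp add: d_def)
  then show "(\<lambda>k. (t gchoose k) * z' ^ k - (t gchoose k) * z ^ k - d k) sums
        (binom_series t z' - binom_series t z - (z' - z) * t * binom_series (t - 1) z)"
    by (intro ultrametric_sums_diff binom_series_sums assms)
  fix k
  have "vabs ((t gchoose k) * z' ^ k - (t gchoose k) * z ^ k - d k)
      = vabs (t gchoose k) * vabs (z' ^ k - z ^ k - of_nat k * (z' - z) * z ^ (k - 1))"
    by (simp add: d_def flip: vabs_mult right_diff_distrib)
  also have "\<dots> \<le> real p ^ k * (p\<^sup>2 * (vabs (z' - z) ^ 2 * (1 / p) ^ k))"
    using vabs_gbinomial_le[OF assms(1)] vabs_power_diff_second_order_le[OF assms(2,3), of k] p_pos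
    by (intro mult_mono) (auto simp: power_one_over field_simps)
  also have "\<dots> = p\<^sup>2 * vabs (z' - z) ^ 2"
    using p_pos by (simp add: power_one_over)
  finally show "vabs ((t gchoose k) * z' ^ k - (t gchoose k) * z ^ k - d k) \<le> p\<^sup>2 * vabs (z' - z) ^ 2" .
qed

end


section \<open>Fermionic integrals and Euler polynomials\<close>

text \<open>A relational form, since the value \<open>lim\<close> alone does not record convergence,
  on which the rules for differences and multiples depend.\<close>

definition has_fermionic_integral :: "nat \<Rightarrow> ('a::ultrametric_field \<Rightarrow> 'a) \<Rightarrow> 'a \<Rightarrow> bool" where
  "has_fermionic_integral p f I \<longleftrightarrow> (\<lambda>N. \<Sum>a<p ^ N. (- 1) ^ a * f (of_nat a)) \<longlonglongrightarrow> I"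

section \<open>Rules for fermionic integrals\<close>

lemma fermionic_integral_unique: "has_fermionic_integral p f I \<Longrightarrow> fermionic_integral p f = I"
  by (simp add: has_fermionic_integral_def fermionic_integral_def limI)

lemma has_fermionic_integral_cong:
  assumes "has_fermionic_integral p f I" "\<And>a. f (of_nat a) = g (of_nat a)"
  shows "has_fermionic_integral p g I"
  using assms by (simp add: has_fermionic_integral_def)

lemma has_fermionic_integral_cmult:
  assumes "has_fermionic_integral p f I"
  shows "has_fermionic_integral p (\<lambda>a. c * f a) (c * I)"
  using tendsto_mult_left[OF assms[unfolded has_fermionic_integral_def], of c]
  by (simp add: has_fermionic_integral_def sum_distrib_left mult_ac)

lemma has_fermionic_integral_diff:
  assumes "has_fermionic_integral p f I" "has_fermionic_integral p g J"
  shows "has_fermionic_integral p (\<lambda>a. f a - g a) (I - J)"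
  using tendsto_diff[OF assms[unfolded has_fermionic_integral_def]]
  by (simp add: has_fermionic_integral_def sum_subtractf right_diff_distrib)

lemma vabs_fermionic_integral_le:
  assumes "has_fermionic_integral p f I" "\<And>a. vabs (f (of_nat a)) \<le> B"
  shows "vabs I \<le> B"
  by (rule vabs_lim_le[OF assms(1)[unfolded has_fermionic_integral_def]], rule vabs_sum_le)
     (use assms(2) order_trans[OF vabs_nonneg] in \<open>auto simp: vabs_mult\<close>)

section \<open>Euler polynomials and alternating power sums\<close>

lemma sum_alternating: "(\<Sum>i<n. (- 1) ^ i) = (if even n then 0 else (1 :: 'a::ring_1))"
  by (induction n) auto

lemma fps_nth_2_exp: "fps_nth (2 * fps_exp x) n = 2 * (x ^ n * (1 / fact n) :: 'a::field_char_0)"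
  by (simp only: numeral_fps_const fps_mult_left_const_nth fps_exp_nth)
     (simp add: divide_inverse)

text \<open>Adding the generating functions at \<open>x + 1\<close> and \<open>x\<close> produces
  the factor \<open>fps_exp 1 + 1\<close>, which cancels the denominator.\<close>

lemma euler_poly_add:
  "euler_poly m (x + 1) + euler_poly m x = 2 * (x :: 'a::field_char_0) ^ m"
proof -
  define D where "D = fps_exp (1 :: 'a) + 1"
  \<comment> \<open>The constant coefficient is 2, so \<open>D\<close> is an invertible power
    series.\<close>
  have D: "fps_nth D 0 \<noteq> 0"
    by (simp add: D_def)
  have "2 * fps_exp (x + 1) / D + 2 * fps_exp x / D = 2 * fps_exp x * (D * inverse D)"
    using D by (simp add: fps_divide_unit fps_exp_add_mult D_def algebra_simps)
  also have "\<dots> = 2 * fps_exp x"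
    by (simp only: inverse_mult_eq_1'[OF D] mult_1_right)
  finally have "fps_nth (2 * fps_exp (x + 1) / D) m + fps_nth (2 * fps_exp x / D) m = 2 * (x ^ m * (1 / fact m))"
    by (simp only: fps_nth_2_exp flip: fps_add_nth)
  then have "fact m * (fps_nth (2 * fps_exp (x + 1) / D) m + fps_nth (2 * fps_exp x / D) m) = 2 * x ^ m"
    by simp
  then show ?thesis
    by (simp add: euler_poly_def D_def distrib_left)
qed

text \<open>The Cauchy product with \<open>H\<close> exhibits \<open>euler_poly m\<close> as a
  polynomial in \<open>x\<close>, hence as a continuous function.\<close>

lemma tendsto_euler_poly:
  assumes "(f \<longlongrightarrow> (l :: 'a::ultrametric_field)) F"
  shows "((\<lambda>x. euler_poly m (f x)) \<longlongrightarrow> euler_poly m l) F"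
proof -
  define H where "H = inverse (fps_exp (1 :: 'a) + 1)"
  have "euler_poly m x = fact m * (\<Sum>i = 0..m. 2 * (x ^ i * (1 / fact i)) * fps_nth H (m - i))" for x
    by (simp add: euler_poly_def fps_divide_unit fps_mult_nth[of _ H] fps_nth_2_exp flip: H_def)
  then show ?thesis
    by (simp only:) (intro tendsto_mult tendsto_const tendsto_sum tendsto_power_strong assms)
qed

lemma sum_alternating_powers:
  fixes x :: "'a::field_char_0"
  shows "2 * (\<Sum>a<n. (- 1) ^ a * (x + of_nat a) ^ m) = euler_poly m x - (- 1) ^ n * euler_poly m (x + of_nat n)"
proof (induction n)
  case (Suc n)
  have "2 * (x + of_nat n) ^ m = euler_poly m (x + of_nat (Suc n)) + euler_poly m (x + of_nat n)"
    using euler_poly_add[of m "x + of_nat n"] by (simp add: add_ac)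
  then have "2 * ((- 1) ^ n * (x + of_nat n) ^ m)
      = (- 1) ^ n * (euler_poly m (x + of_nat (Suc n)) + euler_poly m (x + of_nat n))"
    by (metis mult.left_commute)
  then show ?case
    using Suc by (simp add: distrib_left distrib_right)
qed simp

section \<open>Existence and values of fermionic integrals\<close>

context padic_field
begin

lemma vabs_p_power: "vabs (of_nat (p ^ N) :: 'a) = (1 / p) ^ N"
  by (simp add: vabs_power vabs_p)

lemma p_power_tendsto_0: "(\<lambda>N. of_nat (p ^ N) :: 'a) \<longlonglongrightarrow> 0"
  unfolding tendsto_vabs_iff diff_zero vabs_p_power
  using p_gt_2 by (intro LIMSEQ_realpow_zero) auto

text \<open>
  Splitting the range \<open>a < p ^ (N + 1)\<close> as \<open>a = b + i * p ^ N\<close> and using \<open>\<Sum>i<p. (- 1) ^ i = 1\<close>,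
  consecutive partial sums differ by alternating sums of differences \<open>f (b + i * p ^ N) - f b\<close>.
\<close>

lemma has_fermionic_integral_lipschitz:
  fixes f :: "'a \<Rightarrow> 'a"
  assumes lip: "\<And>a b :: nat. vabs (f (of_nat a) - f (of_nat b)) \<le> C * vabs (of_nat a - of_nat b :: 'a)"
  shows "has_fermionic_integral p f (fermionic_integral p f)"
proof -
  define S where "S N = (\<Sum>a<p ^ N. (- 1) ^ a * f (of_nat a))" for N
  have C: "C \<ge> 0"
    using order_trans[OF vabs_nonneg lip[of 1 0]] by simp
  have diff: "vabs (S (Suc N) - S N) \<le> C * (1 / p) ^ N" for N
  proof -
    define q where "q = p ^ N"
    have "S (Suc N) = (\<Sum>i<p. \<Sum>a = i * q..<i * q + q. (- 1) ^ a * f (of_nat a))"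
      unfolding S_def q_def by (simp add: sum.nat_group)
    also have "\<dots> = (\<Sum>i<p. \<Sum>b<q. (- 1) ^ i * ((- 1) ^ b * f (of_nat (i * q + b))))"
    proof (rule sum.cong[OF refl])
      fix i
      \<comment> \<open>Since \<open>q\<close> is a power of the odd number \<open>p\<close>,
        shifting by \<open>i * q\<close> changes the sign exactly as shifting by
        \<open>i\<close>.\<close>
      have "(- 1 :: 'a) ^ (i * q) = (- 1) ^ i"
        using odd_p by (auto simp: q_def minus_one_power_iff)
      then show "(\<Sum>a = i * q..<i * q + q. (- 1) ^ a * f (of_nat a))
          = (\<Sum>b<q. (- 1) ^ i * ((- 1) ^ b * f (of_nat (i * q + b))))"
        using sum.shift_bounds_nat_ivl[of "\<lambda>a. (- 1) ^ a * f (of_nat a)" 0 "i * q" q]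
        by (simp add: power_add mult_ac add_ac atLeast0LessThan)
    qed
    finally have Suc: "S (Suc N) = (\<Sum>i<p. \<Sum>b<q. (- 1) ^ i * ((- 1) ^ b * f (of_nat (i * q + b))))" .
    have "S N = (\<Sum>i<p. (- 1) ^ i) * (\<Sum>b<q. (- 1) ^ b * f (of_nat b))"
      using odd_p by (simp add: sum_alternating S_def q_def)
    also have "\<dots> = (\<Sum>i<p. \<Sum>b<q. (- 1) ^ i * ((- 1) ^ b * f (of_nat b)))"
      by (simp add: sum_product)
    finally have "S (Suc N) - S N
        = (\<Sum>i<p. \<Sum>b<q. (- 1) ^ i * ((- 1) ^ b * (f (of_nat (i * q + b)) - f (of_nat b))))"
      by (simp add: Suc sum_subtractf right_diff_distrib)
    also have "vabs \<dots> \<le> C * (1 / p) ^ N"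
    proof (intro vabs_sum_le)
      fix i b
      have "vabs (f (of_nat (i * q + b)) - f (of_nat b)) \<le> C * vabs (of_nat (i * q) :: 'a)"
        using lip[of "i * q + b" b] by simp
      also have "vabs (of_nat (i * q) :: 'a) \<le> 1 * (1 / p) ^ N"
        unfolding of_nat_mult vabs_mult q_def vabs_p_power
        by (intro mult_right_mono vabs_of_nat_le_1) simp
      finally show "vabs ((- 1) ^ i * ((- 1) ^ b * (f (of_nat (i * q + b)) - f (of_nat b)))) \<le> C * (1 / p) ^ N"
        using C by (simp add: vabs_mult mult_left_mono)
    qed (use C in auto)
    finally show ?thesis .
  qed
  have "(\<lambda>N. C * (1 / p) ^ N) \<longlonglongrightarrow> C * 0"
    using p_gt_2 by (intro tendsto_mult tendsto_const LIMSEQ_realpow_zero) auto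
  then have "convergent S"
    by (intro convergent_if_diff_tendsto_0 tendsto_0_if_vabs_le[OF diff]) simp
  then show ?thesis
    unfolding has_fermionic_integral_def fermionic_integral_def S_def [symmetric]
    by (simp add: convergent_LIMSEQ_iff)
qed

text \<open>As \<open>p ^ N\<close> is odd, the partial sum is the mean of the values of
  \<open>euler_poly m\<close> at \<open>x\<close> and at \<open>x + of_nat (p ^ N)\<close>, and
  \<open>p ^ N\<close> tends to 0.\<close>

lemma has_fermionic_integral_power:
  fixes x :: 'a
  shows "has_fermionic_integral p (\<lambda>a. (x + a) ^ m) (euler_poly m x)"
proof -
  have "(\<lambda>N. euler_poly m (x + of_nat (p ^ N))) \<longlonglongrightarrow> euler_poly m (x + 0)"
    by (intro tendsto_euler_poly tendsto_add tendsto_const p_power_tendsto_0)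
  then have "(\<lambda>N. (1 / 2) * (euler_poly m x + euler_poly m (x + of_nat (p ^ N))))
      \<longlonglongrightarrow> (1 / 2) * (euler_poly m x + euler_poly m (x + 0))"
    by (intro tendsto_mult tendsto_add tendsto_const)
  moreover have "(1 / 2) * (euler_poly m x + euler_poly m (x + of_nat (p ^ N)))
      = (\<Sum>a<p ^ N. (- 1) ^ a * (x + of_nat a) ^ m)" for N
  proof -
    have "(- 1 :: 'a) ^ (p ^ N) = - 1"
      using odd_p by simp
    then show ?thesis
      using sum_alternating_powers[where n = "p ^ N" and x = x and m = m] by (simp add: field_simps)
  qed
  ultimately show ?thesis
    by (simp add: has_fermionic_integral_def)
qed

section \<open>The zeta integrand on the unit ball around \<open>x\<close>\<close>

lemma add_of_nat_near:
  assumes "x \<in> (Qp :: 'a set)" "y \<in> Qp" "vabs (y - x) \<le> 1"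
  shows "y + of_nat a \<in> Qp" "vabs (y + of_nat a - x) \<le> 1"
  using Qp_add[OF assms(2) of_nat_in_Qp, of a] vabs_add_le[OF assms(3) vabs_of_nat_le_1, of a]
  by (simp_all add: algebra_simps)

text \<open>All translates \<open>y + of_nat a\<close> stay in the unit ball around
  \<open>x\<close>, so a single constant \<open>omega_v p x\<close> serves every
  \<open>a\<close>.\<close>

lemma angle_pow_near:
  assumes "x \<in> (Qp - Zp :: 'a set)" "y \<in> Qp" "vabs (y - x) \<le> 1"
  shows "angle_pow p (y + of_nat a) t = binom_series t ((y + of_nat a) / omega_v p x - 1)"
    and "vabs ((y + of_nat a) / omega_v p x - 1) \<le> 1 / p"
  using angle_proj_near[OF assms(1) add_of_nat_near] assms
  by (simp_all add: angle_pow_def binom_series_def)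

text \<open>The Lipschitz bound for the binomial series makes the integrand Lipschitz in
  \<open>a\<close>. The parameter is the exponent \<open>t\<close>, so that \<open>- m\<close>,
  \<open>1 - s\<close> and \<open>- s\<close> can be substituted directly.\<close>

lemma has_fermionic_integral_angle_pow:
  assumes x: "x \<in> (Qp - Zp :: 'a set)" and t: "vabs t < R_p p"
  shows "has_fermionic_integral p (\<lambda>a. angle_pow p (x + a) t) (zeta_pE p (1 - t) x)"
proof -
  define w where "w = omega_v p x"
  have "vabs (angle_pow p (x + of_nat a) t - angle_pow p (x + of_nat b) t)
      \<le> p / vabs w * vabs (of_nat a - of_nat b :: 'a)" for a b
  proof -
    have "vabs (angle_pow p (x + of_nat a) t - angle_pow p (x + of_nat b) t)
        \<le> p * vabs ((x + of_nat a) / w - 1 - ((x + of_nat b) / w - 1))"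
      using x binom_series_lipschitz[OF t angle_pow_near(2)[OF x] angle_pow_near(2)[OF x]]
      by (simp add: angle_pow_near(1)[OF x] w_def)
    also have "(x + of_nat a) / w - 1 - ((x + of_nat b) / w - 1) = (of_nat a - of_nat b) / w"
      by (simp add: diff_divide_distrib add_divide_distrib)
    finally show ?thesis
      by (simp add: vabs_divide)
  qed
  from has_fermionic_integral_lipschitz[OF this] show ?thesis
    by (simp add: zeta_pE_def)
qed

section \<open>Integer arguments, Euler polynomials and the derivative\<close>

theorem zeta_pE_of_int:
  assumes x: "x \<in> (Qp - Zp :: 'a set)"
  shows "zeta_pE p (1 + of_int m) x =
           omega_v p x powi m * fermionic_integral p (\<lambda>a. 1 / (x + a) powi m)"
proof -
  define w where "w = omega_v p x"
  have w: "w \<noteq> 0"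
    unfolding w_def using Qp_minus_Zp_vabs_ge[OF x] p_pos x by (intro omega_v_props) auto
  have pow: "angle_pow p (x + of_nat a) (of_int (- m)) = w powi m * (1 / (x + of_nat a) powi m)" for a
    using binom_series_of_int[OF angle_pow_near(2)[OF x, of x a], where n = "- m"] x
    by (simp add: angle_pow_near(1)[OF x] w_def power_int_minus power_int_divide_distrib field_simps)
  have "has_fermionic_integral p (\<lambda>a. angle_pow p (x + a) (of_int (- m))) (zeta_pE p (1 + of_int m) x)"
    using has_fermionic_integral_angle_pow[OF x vabs_of_int_less_R_p[of "- m"]] by simp
  then have "has_fermionic_integral p (\<lambda>a. w powi m * (1 / (x + a) powi m)) (zeta_pE p (1 + of_int m) x)"
    by (rule has_fermionic_integral_cong) (rule pow)
  \<comment> \<open>Dividing by the nonzero constant \<open>w powi m\<close> transfers convergence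
    from the zeta integral to the integral of the reciprocal powers.\<close>
  then have "has_fermionic_integral p (\<lambda>a. 1 / w powi m * (w powi m * (1 / (x + a) powi m)))
      (1 / w powi m * zeta_pE p (1 + of_int m) x)"
    by (rule has_fermionic_integral_cmult)
  then have "fermionic_integral p (\<lambda>a. 1 / (x + a) powi m) = 1 / w powi m * zeta_pE p (1 + of_int m) x"
    using w by (intro fermionic_integral_unique) simp
  then show ?thesis
    using w by (simp add: w_def)
qed

theorem zeta_pE_eq_euler_poly:
  assumes x: "x \<in> (Qp - Zp :: 'a set)"
  shows "zeta_pE p (1 - of_nat m) x = 1 / omega_v p x ^ m * euler_poly m x"
proof -
  have pow: "angle_pow p (x + of_nat a) (of_nat m) = 1 / omega_v p x ^ m * (x + of_nat a) ^ m" for a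
    using binom_series_of_int[OF angle_pow_near(2)[OF x, of x a], where n = "int m"] x
    by (simp add: angle_pow_near(1)[OF x] power_divide)
  have "has_fermionic_integral p (\<lambda>a. angle_pow p (x + a) (of_nat m)) (1 / omega_v p x ^ m * euler_poly m x)"
    by (rule has_fermionic_integral_cong[OF has_fermionic_integral_cmult[OF has_fermionic_integral_power]])
       (simp add: pow)
  then show ?thesis
    by (simp add: zeta_pE_def fermionic_integral_unique)
qed

theorem zeta_pE_has_padic_derivative:
  assumes x: "x \<in> (Qp - Zp :: 'a set)" and s: "vabs s < R_p p"
  shows "has_padic_derivative (zeta_pE p s) ((1 - s) / omega_v p x * zeta_pE p (s + 1) x) x (Qp - Zp)"
proof -
  define w where "w = omega_v p x"
  define D where "D = (1 - s) / w * zeta_pE p (s + 1) x"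
  define t where "t = 1 - s"
  have t: "vabs t < R_p p" "vabs (t - 1) < R_p p"
    using vabs_diff_1_less_R_p[OF s] s by (simp_all add: t_def vabs_minus_commute[of 1])
  have x0: "x \<in> Qp" "x \<noteq> 0"
    using Qp_minus_Zp_vabs_ge[OF x] p_pos x by auto
  have w: "w \<noteq> 0" "vabs w \<ge> p"
    unfolding w_def using omega_v_props(1,2)[OF x0] Qp_minus_Zp_vabs_ge[OF x] by auto
  have quot: "vabs ((zeta_pE p s y - zeta_pE p s x) / (y - x) - D) \<le> vabs (y - x)"
    if y: "y \<in> Qp - Zp" "y \<noteq> x" "vabs (y - x) \<le> 1" for y
  proof -
    have near: "y \<in> Qp" "vabs (y - x) \<le> 1" "vabs (x - x) \<le> 1"
      using y by auto
    \<comment> \<open>The increment of the argument of the binomial series between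
      \<open>x + of_nat a\<close> and \<open>y + of_nat a\<close>; it does not depend on
      \<open>a\<close>, so it can be taken out of the integral.\<close>
    define h where "h = (y - x) / w"
    have I: "has_fermionic_integral p
        (\<lambda>a. angle_pow p (y + a) t - angle_pow p (x + a) t - h * t * angle_pow p (x + a) (t - 1))
        (zeta_pE p s y - zeta_pE p s x - h * t * zeta_pE p (s + 1) x)"
      using has_fermionic_integral_angle_pow[OF y(1) t(1)] has_fermionic_integral_angle_pow[OF x t(1)]
        has_fermionic_integral_angle_pow[OF x t(2)]
      by (intro has_fermionic_integral_diff has_fermionic_integral_cmult) (simp_all add: t_def add.commute)
    have "vabs (zeta_pE p s y - zeta_pE p s x - h * t * zeta_pE p (s + 1) x) \<le> p\<^sup>2 * vabs h ^ 2"
    proof (rule vabs_fermionic_integral_le[OF I])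
      fix a
      have h: "(y + of_nat a) / w - 1 - ((x + of_nat a) / w - 1) = h"
        by (simp add: h_def diff_divide_distrib add_divide_distrib)
      show "vabs (angle_pow p (y + of_nat a) t - angle_pow p (x + of_nat a) t
          - h * t * angle_pow p (x + of_nat a) (t - 1)) \<le> p\<^sup>2 * vabs h ^ 2"
        using binom_series_second_order[OF t(1) angle_pow_near(2)[OF x x0(1) near(3), of a]
            angle_pow_near(2)[OF x near(1,2), of a]]
        by (simp add: angle_pow_near(1)[OF x near(1,2)] angle_pow_near(1)[OF x x0(1) near(3)]
            h flip: w_def)
    qed
    also have "\<dots> = (p / vabs w) ^ 2 * vabs (y - x) ^ 2"
      by (simp add: h_def vabs_divide power_divide)
    \<comment> \<open>The factor \<open>p / vabs w\<close> is at most 1 because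
      \<open>vabs w = vabs x\<close> is at least \<open>p\<close>. The remainder is thus quadratic
      in \<open>y - x\<close>, and division by \<open>y - x\<close> leaves an error tending to
      0.\<close>
    also have "\<dots> \<le> 1 * vabs (y - x) ^ 2"
      using w p_pos by (intro mult_right_mono power_le_one) auto
    finally have "vabs (zeta_pE p s y - zeta_pE p s x - h * t * zeta_pE p (s + 1) x) \<le> vabs (y - x) ^ 2"
      by simp
    moreover have "(zeta_pE p s y - zeta_pE p s x) / (y - x) - D
        = (zeta_pE p s y - zeta_pE p s x - h * t * zeta_pE p (s + 1) x) / (y - x)"
      using y w by (simp add: D_def t_def h_def field_simps)
    ultimately show ?thesis
      using y by (simp add: vabs_divide divide_le_eq power2_eq_square)
  qed
  have "((\<lambda>y. vabs ((zeta_pE p s y - zeta_pE p s x) / (y - x) - D)) \<longlongrightarrow> 0) (at x within Qp - Zp)"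
  proof (rule tendsto_sandwich[OF _ _ tendsto_const])
    show "((\<lambda>y. vabs (y - x)) \<longlongrightarrow> 0) (at x within Qp - Zp)"
      by (simp flip: tendsto_vabs_iff)
    show "\<forall>\<^sub>F y in at x within Qp - Zp. vabs ((zeta_pE p s y - zeta_pE p s x) / (y - x) - D) \<le> vabs (y - x)"
      using quot by (auto simp: eventually_at dist_vabs intro!: exI[of _ 1])
  qed simp
  then show ?thesis
    unfolding has_padic_derivative_def tendsto_vabs_iff by (simp add: D_def w_def)
qed

end

theorem theorem3p9:
  fixes p :: nat and x :: "'a::{ultrametric_field, complete_space}"
  assumes "is_Cp p TYPE('a)" and "odd p" and "x \<in> Qp - Zp"
  shows
    "(\<forall>m::int. m \<noteq> 0 \<longrightarrow>
        zeta_pE p (1 + of_int m) x =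
          omega_v p x powi m * fermionic_integral p (\<lambda>a. 1 / (x + a) powi m)) \<and>
     (\<forall>m::nat. m > 0 \<longrightarrow>
        zeta_pE p (1 - of_nat m) x = 1 / omega_v p x ^ m * euler_poly m x) \<and>
     (\<forall>s::'a. vabs s < R_p p \<longrightarrow>
        has_padic_derivative (\<lambda>y. zeta_pE p s y)
          ((1 - s) / omega_v p x * zeta_pE p (s + 1) x) x (Qp - Zp))"
proof -
  interpret padic_field p "TYPE('a)"
    using assms(1,2) by unfold_locales (auto simp: is_Cp_def)
  show ?thesis
    using zeta_pE_of_int zeta_pE_eq_euler_poly zeta_pE_has_padic_derivative assms(3) by blast
qed

end
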